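(* Let $\mathbb K$ be a field and let $q\in\mathbb K$ be nonzero with $q^2\neq 1$. The algebra $U_q(\mathfrak{sl}_2)$ is isomorphic to the unital associative $\mathbb K$-algebra with generators $x^{\pm1},y,z$ and the following relations: $$xx^{-1}=x^{-1}x=1,\qquad \frac{qxy-q^{-1}yx}{q-q^{-1}}=1,\qquad \frac{qyz-q^{-1}zy}{q-q^{-1}}=1,\qquad \frac{qzx-q^{-1}xz}{q-q^{-1}}=1.$$ An isomorphism from this algebra to $U_q(\mathfrak{sl}_2)$ is given by $$x^{\pm1}\mapsto k^{\pm1},\qquad y\mapsto k^{-1}+f(q-q^{-1}),\qquad z\mapsto k^{-1}-k^{-1}e\,q(q-q^{-1}),$$ and the inverse of this isomorphism is given by $$k^{\pm1}\mapsto x^{\pm1},\qquad f\mapsto (y-x^{-1})(q-q^{-1})^{-1},\qquad e\mapsto (1-xz)q^{-1}(q-q^{-1})^{-1}.$$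
   Context: $U_q(\mathfrak{sl}_2)$ denotes the unital associative $\mathbb K$-algebra with generators $k^{\pm1},e,f$ and relations $kk^{-1}=k^{-1}k=1$, $ke=q^2ek$, $kf=q^{-2}fk$, $ef-fe=\frac{k-k^{-1}}{q-q^{-1}}$. *)

theory Defs
  imports "HOL-Library.Poly_Mapping" "HOL-Algebra.Algebra"
begin

text \<open>
  The ground field is a type \<open>'k\<close> of class \<open>field\<close>. An associative unital algebra over it is
  a record of type \<open>('k, 'a) module\<close>, as in \<open>HOL-Algebra.Module\<close>; the locale \<open>algebra\<close> found
  there is not used because it requires the multiplication to be commutative.
\<close>

text \<open>
  The free monoid on \<open>'g\<close>, written additively because the index monoid of the convolution
  product on \<open>poly_mapping\<close> is additive. The addition is not commutative.
\<close>

datatype 'g fword = FWord (letters: "'g list")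

instantiation fword :: (type) monoid_add
begin

definition zero_fword :: "'g fword"
  where "zero_fword = FWord []"

definition plus_fword :: "'g fword \<Rightarrow> 'g fword \<Rightarrow> 'g fword"
  where "plus_fword u v = FWord (letters u @ letters v)"

instance
  by standard (simp_all add: zero_fword_def plus_fword_def)

end

type_synonym ('g, 'k) free_alg = "'g fword \<Rightarrow>\<^sub>0 'k"

definition gen :: "'g \<Rightarrow> ('g, 'k::field) free_alg"
  where "gen g = Poly_Mapping.single (FWord [g]) 1"

definition scal :: "'k::field \<Rightarrow> ('g, 'k) free_alg"
  where "scal c = Poly_Mapping.single 0 c"

definition free_algebra :: "('k::field, ('g, 'k) free_alg) module"
  where "free_algebra =
    \<lparr>carrier = UNIV, monoid.mult = (*), one = 1, ring.zero = 0, ring.add = (+), smult = (\<lambda>c p. scal c * p)\<rparr>"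

definition quotient_algebra :: "('k, 'a) module \<Rightarrow> 'a set \<Rightarrow> ('k, 'a set) module"
  where "quotient_algebra A I =
    \<lparr>carrier = carrier (A Quot I), monoid.mult = monoid.mult (A Quot I), one = one (A Quot I),
     ring.zero = ring.zero (A Quot I), ring.add = ring.add (A Quot I),
     smult = (\<lambda>c C. \<Union>a\<in>C. I +>\<^bsub>A\<^esub> (c \<odot>\<^bsub>A\<^esub> a))\<rparr>"

text \<open>
  A relation \<open>l = r\<close> is the pair \<open>(l, r)\<close>. Ideals of \<open>HOL-Algebra\<close> are two-sided.
\<close>

definition relation_ideal ::
    "(('g, 'k::field) free_alg \<times> ('g, 'k) free_alg) set \<Rightarrow> ('g, 'k) free_alg set"
  where "relation_ideal R = Idl\<^bsub>free_algebra\<^esub> {l - r | l r. (l, r) \<in> R}"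

definition presented_algebra ::
    "(('g, 'k::field) free_alg \<times> ('g, 'k) free_alg) set \<Rightarrow> ('k, ('g, 'k) free_alg set) module"
  where "presented_algebra R = quotient_algebra free_algebra (relation_ideal R)"

definition presented_gen ::
    "(('g, 'k::field) free_alg \<times> ('g, 'k) free_alg) set \<Rightarrow> 'g \<Rightarrow> ('g, 'k) free_alg set"
  where "presented_gen R g = relation_ideal R +>\<^bsub>free_algebra\<^esub> gen g"

definition algebra_hom :: "('k, 'a) module \<Rightarrow> ('k, 'b) module \<Rightarrow> ('a \<Rightarrow> 'b) set"
  where "algebra_hom A B =
    {h \<in> ring_hom A B. \<forall>c. \<forall>a \<in> carrier A. h (c \<odot>\<^bsub>A\<^esub> a) = c \<odot>\<^bsub>B\<^esub> h a}"

definition algebra_iso :: "('k, 'a) module \<Rightarrow> ('k, 'b) module \<Rightarrow> ('a \<Rightarrow> 'b) set"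
  where "algebra_iso A B = {h \<in> algebra_hom A B. bij_betw h (carrier A) (carrier B)}"

lemma ring_free_algebra: "ring (free_algebra :: ('k::field, ('g, 'k) free_alg) module)"
proof (rule ringI)
  show "abelian_group (free_algebra :: ('k, ('g, 'k) free_alg) module)"
  proof (rule abelian_groupI)
    fix x :: "('g, 'k) free_alg"
    have "- x + x = 0"
      by simp
    then show "\<exists>y\<in>carrier free_algebra. y \<oplus>\<^bsub>free_algebra\<^esub> x = \<zero>\<^bsub>free_algebra\<^esub>"
      unfolding free_algebra_def by (auto intro: exI[of _ "- x"])
  qed (simp_all add: free_algebra_def algebra_simps)
  show "monoid (free_algebra :: ('k, ('g, 'k) free_alg) module)"
    by (rule monoidI) (simp_all add: free_algebra_def algebra_simps)
qed (simp_all add: free_algebra_def algebra_simps)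

lemma ideal_relation_ideal: "ideal (relation_ideal R) free_algebra"
  unfolding relation_ideal_def
  by (rule ring.genideal_ideal[OF ring_free_algebra]) (simp add: free_algebra_def)

lemma presented_smult:
  "c \<odot>\<^bsub>presented_algebra R\<^esub> (relation_ideal R +>\<^bsub>free_algebra\<^esub> p)
    = relation_ideal R +>\<^bsub>free_algebra\<^esub> (scal c * p)"
proof -
  let ?I = "relation_ideal R"
  interpret I: ideal ?I free_algebra
    by (rule ideal_relation_ideal)
  have cos: "?I +>\<^bsub>free_algebra\<^esub> a = {i + a | i. i \<in> ?I}" for a
    unfolding a_r_coset_def r_coset_def by (auto simp: free_algebra_def)
  have mem: "scal c * i \<in> ?I" if "i \<in> ?I" for i
    using I.I_l_closed[OF that, of "scal c"] by (simp add: free_algebra_def)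
  have sum: "i + j \<in> ?I" if "i \<in> ?I" "j \<in> ?I" for i j
    using additive_subgroup.a_closed[OF I.additive_subgroup_axioms that] by (simp add: free_algebra_def)
  have zero: "0 \<in> ?I"
    using additive_subgroup.zero_closed[OF I.additive_subgroup_axioms] by (simp add: free_algebra_def)
  have "(\<Union>a\<in>{i + p | i. i \<in> ?I}. {j + scal c * a | j. j \<in> ?I}) = {j + scal c * p | j. j \<in> ?I}"
  proof (intro equalityI subsetI)
    fix x assume "x \<in> (\<Union>a\<in>{i + p | i. i \<in> ?I}. {j + scal c * a | j. j \<in> ?I})"
    then obtain i j where ij: "i \<in> ?I" "j \<in> ?I" and x: "x = j + scal c * (i + p)"
      by blast
    have "x = (j + scal c * i) + scal c * p"
      by (simp add: x algebra_simps)
    then show "x \<in> {j + scal c * p | j. j \<in> ?I}"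
      using sum[OF ij(2) mem[OF ij(1)]] by blast
  next
    fix x assume "x \<in> {j + scal c * p | j. j \<in> ?I}"
    moreover have "p \<in> {i + p | i. i \<in> ?I}"
      using zero by force
    ultimately show "x \<in> (\<Union>a\<in>{i + p | i. i \<in> ?I}. {j + scal c * a | j. j \<in> ?I})"
      by blast
  qed
  then show ?thesis
    unfolding presented_algebra_def quotient_algebra_def
    by (simp add: cos) (simp add: free_algebra_def)
qed

datatype uq_gen = GK | GKinv | GE | GF

definition uq_relations :: "'k::field \<Rightarrow> ((uq_gen, 'k) free_alg \<times> (uq_gen, 'k) free_alg) set"
  where "uq_relations q =
    (let k = gen GK; k' = gen GKinv; e = gen GE; f = gen GF in
      {(k * k', 1),
       (k' * k, 1),
       (k * e, scal (q ^ 2) * e * k),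
       (k * f, scal (inverse q ^ 2) * f * k),
       (e * f - f * e, scal (1 / (q - inverse q)) * (k - k'))})"

definition Uq_sl2 :: "'k::field \<Rightarrow> ('k, (uq_gen, 'k) free_alg set) module"
  where "Uq_sl2 q = presented_algebra (uq_relations q)"

definition uq :: "'k::field \<Rightarrow> uq_gen \<Rightarrow> (uq_gen, 'k) free_alg set"
  where "uq q = presented_gen (uq_relations q)"

datatype xyz_gen = GX | GXinv | GY | GZ

definition xyz_relations :: "'k::field \<Rightarrow> ((xyz_gen, 'k) free_alg \<times> (xyz_gen, 'k) free_alg) set"
  where "xyz_relations q =
    (let x = gen GX; x' = gen GXinv; y = gen GY; z = gen GZ in
      {(x * x', 1),
       (x' * x, 1),
       (scal (1 / (q - inverse q)) * (scal q * x * y - scal (inverse q) * y * x), 1),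
       (scal (1 / (q - inverse q)) * (scal q * y * z - scal (inverse q) * z * y), 1),
       (scal (1 / (q - inverse q)) * (scal q * z * x - scal (inverse q) * x * z), 1)})"

definition xyz_algebra :: "'k::field \<Rightarrow> ('k, (xyz_gen, 'k) free_alg set) module"
  where "xyz_algebra q = presented_algebra (xyz_relations q)"

definition xyz :: "'k::field \<Rightarrow> xyz_gen \<Rightarrow> (xyz_gen, 'k) free_alg set"
  where "xyz q = presented_gen (xyz_relations q)"

end

theory Submission
  imports Defs
begin

text \<open>
A homomorphism out of an algebra given by generators and relations is the same thing as a choice
of images of the generators that satisfies the relations. So the theorem reduces to finite checks:
the proposed images of \<open>x\<close>, \<open>x\<^sup>-\<^sup>1\<close>, \<open>y\<close>, \<open>z\<close> satisfy, in \<open>U\<^sub>q(sl\<^sub>2)\<close>, the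
relations imposed on \<open>x\<close>, \<open>x\<^sup>-\<^sup>1\<close>, \<open>y\<close>, \<open>z\<close>, the proposed images of \<open>k\<close>, \<open>k\<^sup>-\<^sup>1\<close>, \<open>e\<close>, \<open>f\<close> satisfy the
relations of \<open>U\<^sub>q(sl\<^sub>2)\<close>, and the two composites fix every generator. A homomorphism that fixes the generators is the identity, so the
two maps are then mutually inverse isomorphisms. Lemma \<open>presented_hom_algebra_iso\<close> is this
reduction. It rests on the universal property of the free algebra: \<open>subst F\<close> is the
homomorphism of free algebras that sends each generator \<open>g\<close> to \<open>F g\<close>, and it descends to the
quotients as soon as it sends the relations of the source into the ideal of the target.

The finite checks are \<open>xyz_relations_hold_in_uq\<close>, \<open>uq_relations_hold_in_xyz\<close>,
\<open>uq_image_xyz_image\<close> and \<open>xyz_image_uq_image\<close>. Each of them asserts that an element of a free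
algebra lies in a relation ideal, and is proved by a certificate: the element is written as
an explicit sum of multiples \<open>a * (l - r) * b\<close> of relators. Such an identity holds already in
the free algebra, so that it follows by expanding both sides into words.

The substance of the checks, with \<open>d = q - q\<^sup>-\<^sup>1\<close>, is as follows. After multiplication by \<open>d\<close>,
the relation between \<open>x\<close> and \<open>y\<close> is equivalent to \<open>k f = q\<^sup>-\<^sup>2 f k\<close>, the relation between \<open>z\<close> and
\<open>x\<close> is equivalent to \<open>k e = q\<^sup>2 e k\<close>, and, given those two, the relation between \<open>y\<close> and \<open>z\<close> is
equivalent to the formula for \<open>e f - f e\<close>: all terms of \<open>q y z - q\<^sup>-\<^sup>1 z y\<close> cancel except
\<open>d k\<^sup>-\<^sup>1 k\<^sup>-\<^sup>1 + d\<^sup>2 k\<^sup>-\<^sup>1 (e f - f e)\<close>, which is \<open>d\<close> exactly when \<open>d (e f - f e) = k - k\<^sup>-\<^sup>1\<close>. The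
hypothesis \<open>q\<^sup>2 \<noteq> 1\<close> enters as \<open>d \<noteq> 0\<close>.
\<close>

section \<open>Scalars and induction in the free algebra\<close>

lemma scal_add: "scal (c + d) = scal c + scal d"
  by (simp add: scal_def single_add)

lemma scal_diff: "scal (c - d) = scal c - scal d"
  by (simp add: scal_def single_diff)

lemma scal_mult: "scal (c * d) = scal c * scal d"
  by (simp add: scal_def mult_single)

lemma scal_0 [simp]: "scal 0 = 0"
  by (simp add: scal_def)

lemma scal_1 [simp]: "scal 1 = 1"
  by (simp add: scal_def)

lemma single_eq_scal_mult: "Poly_Mapping.single w c = scal c * Poly_Mapping.single w 1"
  by (simp add: scal_def mult_single)

lemma update_eq_single_add:
  "w \<notin> Poly_Mapping.keys p \<Longrightarrow> Poly_Mapping.update w c p = Poly_Mapping.single w c + p"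
  by (rule poly_mapping_eqI)
     (auto simp: lookup_update lookup_add lookup_single when_def in_keys_iff)

text \<open>
Scalars and generators generate the free algebra as a ring. Statements compatible with sums and
products, such as centrality of scalars or agreement of two homomorphisms modulo an ideal, need
only be checked there.
\<close>

lemma free_alg_induct [case_names scal gen add mult]:
  fixes p :: "('g, 'k::field) free_alg"
  assumes scal: "\<And>c. P (scal c)"
    and gen: "\<And>g. P (gen g)"
    and add: "\<And>a b. P a \<Longrightarrow> P b \<Longrightarrow> P (a + b)"
    and mult: "\<And>a b. P a \<Longrightarrow> P b \<Longrightarrow> P (a * b)"
  shows "P p"
proof -
  have word: "P (Poly_Mapping.single (FWord gs) 1)" for gs
  proof (induction gs)
    case Nil
    show ?case
      using scal[of 1] by (simp add: scal_def zero_fword_def)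
  next
    case (Cons g gs)
    have "Poly_Mapping.single (FWord (g # gs)) 1
        = (gen g * Poly_Mapping.single (FWord gs) 1 :: ('g, 'k) free_alg)"
      by (simp add: gen_def mult_single plus_fword_def)
    then show ?case
      using mult[OF gen Cons.IH] by simp
  qed
  have single: "P (Poly_Mapping.single w c)" for w c
    using mult[OF scal word, of c "letters w"] by (simp flip: single_eq_scal_mult)
  show ?thesis
  proof (induction p rule: update_induct)
    case const
    show ?case
      using scal[of 0] by simp
  next
    case (update p w c)
    then show ?case
      by (simp add: update_eq_single_add add single)
  qed
qed

lemma scal_commute: "p * scal c = scal c * p"
proof (induction p rule: free_alg_induct)
  case (scal d)
  show ?case
    by (simp add: mult.commute flip: scal_mult)
next
  case (gen g)
  show ?case
    by (simp add: gen_def scal_def mult_single)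
next
  case (add a b)
  then show ?case
    by (simp add: algebra_simps)
next
  case (mult a b)
  have "a * b * scal c = a * scal c * b"
    using mult(2) by (simp add: mult.assoc)
  also have "\<dots> = scal c * (a * b)"
    by (simp add: mult(1) mult.assoc)
  finally show ?case .
qed

lemma scal_left_commute: "p * (scal c * r) = scal c * (p * r)"
  by (simp add: scal_commute flip: mult.assoc)

section \<open>Substitution homomorphisms\<close>

text \<open>
The extension of \<open>F\<close> to an algebra homomorphism: a word goes to the product of the images of its
letters, and this is extended linearly.
\<close>

definition subst :: "('g \<Rightarrow> ('h, 'k::field) free_alg) \<Rightarrow> ('g, 'k) free_alg \<Rightarrow> ('h, 'k) free_alg"
  where "subst F p = (\<Sum>w \<in> Poly_Mapping.keys p.
    scal (Poly_Mapping.lookup p w) * prod_list (map F (letters w)))"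

lemma subst_single: "subst F (Poly_Mapping.single w c) = scal c * prod_list (map F (letters w))"
  by (cases "c = 0") (simp_all add: subst_def)

lemma subst_scal [simp]: "subst F (scal c) = scal c"
  by (simp add: scal_def subst_single zero_fword_def)

lemma subst_1 [simp]: "subst F 1 = 1"
  using subst_scal[of F 1] by simp

lemma subst_gen [simp]: "subst F (gen g) = F g"
  by (simp add: gen_def subst_single)

lemma subst_add [simp]: "subst F (p + r) = subst F p + subst F r"
proof -
  let ?W = "Poly_Mapping.keys p \<union> Poly_Mapping.keys r"
  have on_W: "subst F s = (\<Sum>w\<in>?W. scal (Poly_Mapping.lookup s w) * prod_list (map F (letters w)))"
    if "Poly_Mapping.keys s \<subseteq> ?W" for s
    unfolding subst_def using that by (intro sum.mono_neutral_left) (auto simp: in_keys_iff)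
  show ?thesis
    by (simp add: on_W keys_add lookup_add scal_add distrib_right sum.distrib)
qed

lemma subst_diff [simp]: "subst F (p - r) = subst F p - subst F r"
  using subst_add[of F "p - r" r] by (simp add: eq_diff_eq)

text \<open>
The left factor is a monomial, so that multiplicativity follows from additivity in the right
factor and from \<open>mult_single\<close>; centrality of scalars lets the coefficient of the right factor pass
the image of the left word. Additivity in the left factor then gives the general case.
\<close>

lemma subst_single_mult:
  "subst F (Poly_Mapping.single v c * p) = subst F (Poly_Mapping.single v c) * subst F p"
proof (induction p rule: update_induct)
  case const
  show ?case
    by (simp add: subst_def)
next
  case (update p w d)
  have "subst F (Poly_Mapping.single v c * Poly_Mapping.single w d)
      = subst F (Poly_Mapping.single v c) * subst F (Poly_Mapping.single w d)"
    by (simp add: mult_single subst_single plus_fword_def scal_mult mult.assoc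
        scal_left_commute[of "prod_list _"])
  then show ?case
    using update by (simp add: update_eq_single_add distrib_left)
qed

lemma subst_mult [simp]: "subst F (p * r) = subst F p * subst F r"
proof (induction p rule: update_induct)
  case const
  show ?case
    by (simp add: subst_def)
next
  case (update p v c)
  then show ?case
    by (simp add: update_eq_single_add distrib_right subst_single_mult)
qed

section \<open>Relation ideals and residue classes\<close>

text \<open>
The axioms of a two-sided ideal with the type class operations in place of the fields of the record
\<open>free_algebra\<close>, which is the form that the simplifier can work with.
\<close>

lemma relation_ideal_closed:
  fixes R :: "(('g, 'k::field) free_alg \<times> ('g, 'k) free_alg) set"
  shows relation_ideal_zero: "0 \<in> relation_ideal R"
    and relation_ideal_add: "a \<in> relation_ideal R \<Longrightarrow> b \<in> relation_ideal R \<Longrightarrow> a + b \<in> relation_ideal R"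
    and relation_ideal_lmult: "a \<in> relation_ideal R \<Longrightarrow> c * a \<in> relation_ideal R"
    and relation_ideal_rmult: "a \<in> relation_ideal R \<Longrightarrow> a * c \<in> relation_ideal R"
proof -
  interpret I: ideal "relation_ideal R" free_algebra
    by (rule ideal_relation_ideal)
  show "0 \<in> relation_ideal R"
    using additive_subgroup.zero_closed[OF I.additive_subgroup_axioms] by (simp add: free_algebra_def)
  show "a + b \<in> relation_ideal R" if "a \<in> relation_ideal R" "b \<in> relation_ideal R"
    using additive_subgroup.a_closed[OF I.additive_subgroup_axioms that] by (simp add: free_algebra_def)
  show "c * a \<in> relation_ideal R" "a * c \<in> relation_ideal R" if "a \<in> relation_ideal R"
    using I.I_l_closed[OF that, of c] I.I_r_closed[OF that, of c] by (simp_all add: free_algebra_def)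
qed

lemma relation_ideal_uminus: "a \<in> relation_ideal R \<Longrightarrow> - a \<in> relation_ideal R"
  using relation_ideal_lmult[of a R "- 1"] by simp

lemma relation_ideal_diff:
  "a \<in> relation_ideal R \<Longrightarrow> b \<in> relation_ideal R \<Longrightarrow> a - b \<in> relation_ideal R"
  using relation_ideal_add[OF _ relation_ideal_uminus, of a R b] by simp

lemmas relation_ideal_sums = relation_ideal_add relation_ideal_diff
lemmas relation_ideal_multiples = relation_ideal_lmult relation_ideal_rmult

lemma relation_in_relation_ideal: "(l, r) \<in> R \<Longrightarrow> l - r \<in> relation_ideal R"
  unfolding relation_ideal_def
  using ring.genideal_self[OF ring_free_algebra, of "{l - r | l r. (l, r) \<in> R}"]
  by (auto simp: free_algebra_def)

text \<open>
The relation ideal is the least two-sided ideal containing the relators. Closure under negation is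
multiplication by \<open>- 1\<close>.
\<close>

lemma relation_ideal_subset:
  fixes R :: "(('g, 'k::field) free_alg \<times> ('g, 'k) free_alg) set"
  assumes rel: "\<And>l r. (l, r) \<in> R \<Longrightarrow> l - r \<in> J"
    and zero: "0 \<in> J" and add: "\<And>a b. a \<in> J \<Longrightarrow> b \<in> J \<Longrightarrow> a + b \<in> J"
    and lmult: "\<And>a c. a \<in> J \<Longrightarrow> c * a \<in> J" and rmult: "\<And>a c. a \<in> J \<Longrightarrow> a * c \<in> J"
  shows "relation_ideal R \<subseteq> J"
  unfolding relation_ideal_def
proof (rule ring.genideal_minimal[OF ring_free_algebra])
  interpret A: ring "free_algebra :: ('k, ('g, 'k) free_alg) module"
    by (rule ring_free_algebra)
  have uminus: "\<ominus>\<^bsub>free_algebra\<^esub> a \<in> J" if "a \<in> J" for a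
  proof -
    have "\<ominus>\<^bsub>free_algebra\<^esub> a = - a"
      by (rule A.minus_equality) (simp_all add: free_algebra_def)
    then show ?thesis
      using lmult[OF that, of "- 1"] by simp
  qed
  show "ideal J free_algebra"
  proof (rule idealI[OF ring_free_algebra])
    show "subgroup J (add_monoid free_algebra)"
      by (rule A.add.subgroupI) (use zero add uminus in \<open>auto simp: free_algebra_def a_inv_def\<close>)
  qed (auto simp: free_algebra_def lmult rmult)
  show "{l - r | l r. (l, r) \<in> R} \<subseteq> J"
    using rel by blast
qed

definition cls :: "(('g, 'k::field) free_alg \<times> ('g, 'k) free_alg) set \<Rightarrow> ('g, 'k) free_alg
    \<Rightarrow> ('g, 'k) free_alg set"
  where "cls R p = relation_ideal R +>\<^bsub>free_algebra\<^esub> p"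

lemma mem_cls_iff: "a \<in> cls R p \<longleftrightarrow> a - p \<in> relation_ideal R"
  unfolding cls_def a_r_coset_def r_coset_def
  by (auto simp: free_algebra_def intro!: bexI[of _ "a - p"])

lemma cls_eq_iff: "cls R p = cls R r \<longleftrightarrow> p - r \<in> relation_ideal R"
proof
  assume "cls R p = cls R r"
  then show "p - r \<in> relation_ideal R"
    using mem_cls_iff[of p R r] mem_cls_iff[of p R p] by (simp add: relation_ideal_zero)
next
  assume pr: "p - r \<in> relation_ideal R"
  show "cls R p = cls R r"
  proof (rule Set.set_eqI)
    fix a
    show "a \<in> cls R p \<longleftrightarrow> a \<in> cls R r"
      using relation_ideal_add[OF _ pr, of "a - p"] relation_ideal_diff[OF _ pr, of "a - r"]
      by (auto simp: mem_cls_iff algebra_simps)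
  qed
qed

lemma presented_gen_eq_cls: "presented_gen R g = cls R (gen g)"
  by (simp add: presented_gen_def cls_def)

lemma carrier_presented_algebra: "carrier (presented_algebra R) = range (cls R)"
  by (auto simp: presented_algebra_def quotient_algebra_def FactRing_simps cls_def[abs_def])
     (auto simp: free_algebra_def)

lemma presented_algebra_cls:
  shows cls_closed: "cls R p \<in> carrier (presented_algebra R)"
    and cls_mult: "cls R p \<otimes>\<^bsub>presented_algebra R\<^esub> cls R r = cls R (p * r)"
    and cls_add: "cls R p \<oplus>\<^bsub>presented_algebra R\<^esub> cls R r = cls R (p + r)"
    and cls_one: "\<one>\<^bsub>presented_algebra R\<^esub> = cls R 1"
    and cls_zero: "\<zero>\<^bsub>presented_algebra R\<^esub> = cls R 0"
    and cls_smult: "c \<odot>\<^bsub>presented_algebra R\<^esub> cls R p = cls R (scal c * p)"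
proof -
  interpret I: ideal "relation_ideal R" free_algebra
    by (rule ideal_relation_ideal)
  show "cls R p \<in> carrier (presented_algebra R)"
    by (simp add: carrier_presented_algebra)
  show "cls R p \<otimes>\<^bsub>presented_algebra R\<^esub> cls R r = cls R (p * r)"
    using I.rcoset_mult_add[of p r]
    by (simp add: presented_algebra_def quotient_algebra_def FactRing_def cls_def)
       (simp add: free_algebra_def)
  show "cls R p \<oplus>\<^bsub>presented_algebra R\<^esub> cls R r = cls R (p + r)"
    using I.a_rcos_sum[of p r]
    by (simp add: presented_algebra_def quotient_algebra_def FactRing_def cls_def)
       (simp add: free_algebra_def)
  show "\<one>\<^bsub>presented_algebra R\<^esub> = cls R 1"
    by (simp add: presented_algebra_def quotient_algebra_def FactRing_def cls_def)
       (simp add: free_algebra_def)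
  show "\<zero>\<^bsub>presented_algebra R\<^esub> = cls R 0"
    by (auto simp: presented_algebra_def quotient_algebra_def FactRing_def mem_cls_iff)
  show "c \<odot>\<^bsub>presented_algebra R\<^esub> cls R p = cls R (scal c * p)"
    by (simp add: cls_def presented_smult)
qed

text \<open>
Subtraction in a record is defined through inverses in its additive group; this lemma serves to
compute it on residue classes.
\<close>

lemma abelian_group_presented_algebra: "abelian_group (presented_algebra R)"
proof (rule abelian_groupI)
  fix C assume "C \<in> carrier (presented_algebra R)"
  then obtain p where "C = cls R p"
    by (auto simp: carrier_presented_algebra)
  then show "\<exists>D\<in>carrier (presented_algebra R). D \<oplus>\<^bsub>presented_algebra R\<^esub> C = \<zero>\<^bsub>presented_algebra R\<^esub>"
    by (intro bexI[of _ "cls R (- p)"]) (simp_all add: presented_algebra_cls)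
qed (auto simp: carrier_presented_algebra cls_add cls_zero add_ac)

lemma cls_diff: "cls R p \<ominus>\<^bsub>presented_algebra R\<^esub> cls R r = cls R (p - r)"
proof -
  have "\<ominus>\<^bsub>presented_algebra R\<^esub> cls R r = cls R (- r)"
    by (rule abelian_group.minus_equality[OF abelian_group_presented_algebra])
       (simp_all add: presented_algebra_cls)
  then show ?thesis
    by (simp add: a_minus_def cls_add)
qed

section \<open>Homomorphisms between presented algebras\<close>

text \<open>
The preimage of an ideal under a homomorphism is an ideal, so that it contains the whole relation
ideal once it contains the relators.
\<close>

lemma subst_relation_ideal:
  assumes "\<And>l r. (l, r) \<in> R \<Longrightarrow> subst F l - subst F r \<in> relation_ideal S"
    and "p \<in> relation_ideal R"
  shows "subst F p \<in> relation_ideal S"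
proof -
  have "relation_ideal R \<subseteq> {p. subst F p \<in> relation_ideal S}"
    by (rule relation_ideal_subset)
       (use assms(1) in \<open>simp_all add: relation_ideal_closed subst_scal[of F 0, simplified]\<close>)
  then show ?thesis
    using assms(2) by blast
qed

text \<open>
A function on residue classes must not depend on representatives. Taking the union over all
representatives avoids a choice: if \<open>F\<close> respects the relations, all members of the union coincide.
\<close>

definition presented_hom :: "('g \<Rightarrow> ('h, 'k::field) free_alg)
    \<Rightarrow> (('h, 'k) free_alg \<times> ('h, 'k) free_alg) set \<Rightarrow> ('g, 'k) free_alg set \<Rightarrow> ('h, 'k) free_alg set"
  where "presented_hom F S C = (\<Union>p\<in>C. cls S (subst F p))"

lemma presented_hom_cls:
  assumes "\<And>l r. (l, r) \<in> R \<Longrightarrow> subst F l - subst F r \<in> relation_ideal S"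
  shows "presented_hom F S (cls R p) = cls S (subst F p)"
proof -
  have "cls S (subst F a) = cls S (subst F p)" if "a \<in> cls R p" for a
    using subst_relation_ideal[OF assms, where p = "a - p"] that by (simp add: mem_cls_iff cls_eq_iff)
  moreover have "p \<in> cls R p"
    by (simp add: mem_cls_iff relation_ideal_zero)
  ultimately show ?thesis
    unfolding presented_hom_def by blast
qed

lemma presented_hom_algebra_hom:
  assumes "\<And>l r. (l, r) \<in> R \<Longrightarrow> subst F l - subst F r \<in> relation_ideal S"
  shows "presented_hom F S \<in> algebra_hom (presented_algebra R) (presented_algebra S)"
  unfolding algebra_hom_def
  by (auto intro!: ring_hom_memI
      simp: carrier_presented_algebra presented_algebra_cls presented_hom_cls[OF assms])

text \<open>
The set of elements fixed modulo \<open>relation_ideal R\<close> by the composite contains the scalars and is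
closed under sums and products, so that it is everything once it contains the generators.
\<close>

lemma subst_subst_cong_self:
  assumes "\<And>g. subst G (F g) - gen g \<in> relation_ideal R"
  shows "subst G (subst F p) - p \<in> relation_ideal R"
proof (induction p rule: free_alg_induct)
  case (mult a b)
  have "subst G (subst F (a * b)) - a * b
      = (subst G (subst F a) - a) * subst G (subst F b) + a * (subst G (subst F b) - b)"
    by (simp add: algebra_simps)
  then show ?case
    using mult by (auto intro!: relation_ideal_sums intro: relation_ideal_multiples)
next
  case (add a b)
  then show ?case
    using relation_ideal_add by (fastforce simp: algebra_simps)
qed (simp_all add: assms relation_ideal_zero)

lemma presented_hom_inverse:
  assumes "\<And>l r. (l, r) \<in> R \<Longrightarrow> subst F l - subst F r \<in> relation_ideal S"
    and "\<And>l r. (l, r) \<in> S \<Longrightarrow> subst G l - subst G r \<in> relation_ideal R"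
    and "\<And>g. subst G (F g) - gen g \<in> relation_ideal R"
    and "C \<in> carrier (presented_algebra R)"
  shows "presented_hom G R (presented_hom F S C) = C"
proof -
  obtain p where "C = cls R p"
    using assms(4) by (auto simp: carrier_presented_algebra)
  then show ?thesis
    using subst_subst_cong_self[OF assms(3), of p]
    by (simp add: presented_hom_cls[OF assms(1)] presented_hom_cls[OF assms(2)] cls_eq_iff)
qed

text \<open>
An isomorphism of presented algebras from data on generators: both assignments respect the relations
and both composites fix the generators modulo the relations.
\<close>

lemma presented_hom_algebra_iso:
  assumes "\<And>l r. (l, r) \<in> R \<Longrightarrow> subst F l - subst F r \<in> relation_ideal S"
    and "\<And>l r. (l, r) \<in> S \<Longrightarrow> subst G l - subst G r \<in> relation_ideal R"
    and "\<And>g. subst G (F g) - gen g \<in> relation_ideal R"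
    and "\<And>h. subst F (G h) - gen h \<in> relation_ideal S"
  shows "presented_hom F S \<in> algebra_iso (presented_algebra R) (presented_algebra S)"
proof -
  have maps: "presented_hom F S ` carrier (presented_algebra R) \<subseteq> carrier (presented_algebra S)"
    "presented_hom G R ` carrier (presented_algebra S) \<subseteq> carrier (presented_algebra R)"
    using presented_hom_cls[OF assms(1)] presented_hom_cls[OF assms(2)]
    by (auto simp: carrier_presented_algebra)
  have "bij_betw (presented_hom F S) (carrier (presented_algebra R)) (carrier (presented_algebra S))"
    by (rule bij_betw_byWitness[where f' = "presented_hom G R"])
       (use maps presented_hom_inverse[OF assms(1,2,3)] presented_hom_inverse[OF assms(2,1,4)]
         in auto)
  then show ?thesis
    using presented_hom_algebra_hom[OF assms(1)] by (simp add: algebra_iso_def)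
qed

section \<open>Normal forms in the free algebra\<close>

text \<open>
Collecting the scalars of a monomial in front. Centrality is not a terminating rewrite rule when
both factors are scalars; \<open>NO_MATCH\<close> excludes this case, and \<open>scal_merge\<close> takes care of it.
\<close>

lemma scal_to_left:
  "NO_MATCH (scal b) p \<Longrightarrow> p * scal c = scal c * p"
  "NO_MATCH (scal b) p \<Longrightarrow> p * (scal c * r) = scal c * (p * r)"
  by (rule scal_commute, rule scal_left_commute)

lemma scal_merge: "scal c * scal d = scal (c * d)" "scal c * (scal d * p) = scal (c * d) * p"
  by (simp_all add: scal_mult mult.assoc)

lemma scal_mult_mem_relation_ideal_iff:
  assumes "c \<noteq> 0"
  shows "scal c * p \<in> relation_ideal R \<longleftrightarrow> p \<in> relation_ideal R"
proof
  assume "scal c * p \<in> relation_ideal R"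
  then have "scal (inverse c) * (scal c * p) \<in> relation_ideal R"
    by (rule relation_ideal_lmult)
  then show "p \<in> relation_ideal R"
    using assms by (simp add: scal_merge)
qed (rule relation_ideal_lmult)

text \<open>
The relations among \<open>x\<close>, \<open>y\<close>, \<open>z\<close> have the denominator \<open>q - q\<^sup>-\<^sup>1\<close>; this clears it.
\<close>

lemma cleared_relation_mem_iff:
  assumes "d \<noteq> 0"
  shows "scal (1 / d) * p - 1 \<in> relation_ideal R \<longleftrightarrow> p - scal d \<in> relation_ideal R"
proof -
  have "scal (1 / d) * p - 1 = scal (1 / d) * (p - scal d)"
    using assms by (simp add: right_diff_distrib scal_merge)
  then show ?thesis
    using assms by (simp add: scal_mult_mem_relation_ideal_iff)
qed

text \<open>
Expands an element of the free algebra into words with coefficients in front, where a sum in a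
coefficient is split into separate terms. Two equal elements then become equal sums provided that
equal coefficients have equal normal forms.
\<close>

lemmas free_alg_normalize =
  scal_to_left scal_merge scal_add scal_diff algebra_simps power2_eq_square

text \<open>
Normal forms for coefficients: \<open>q\<close> is eliminated by \<open>q = d + t\<close>, and the rewrite rules from
\<open>q t = 1\<close>, that is \<open>t\<^sup>2 = 1 - d t\<close>, and from \<open>d d\<^sup>-\<^sup>1 = 1\<close> leave polynomials in \<open>d\<close>, \<open>d\<^sup>-\<^sup>1\<close> and \<open>t\<close>
of degree at most one in \<open>t\<close>. The variants with a further factor \<open>c\<close> apply inside longer products.
\<close>

lemma quantum_parameter_rewrites:
  fixes q :: "'k::field"
  assumes "q \<noteq> 0" "q ^ 2 \<noteq> 1" "t = inverse q" "d = q - inverse q"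
  shows "d \<noteq> 0" "q = d + t" "t * t = 1 - d * t" "t * (t * c) = c - d * (t * c)"
    "inverse d * d = 1" "d * inverse d = 1" "inverse d * (d * c) = c" "d * (inverse d * c) = c"
proof -
  have "q ^ 2 = 1" if "q = inverse q"
    using assms(1) that by (metis power2_eq_square right_inverse)
  then show "d \<noteq> 0"
    using assms by auto
  then show "inverse d * d = 1" "d * inverse d = 1" "inverse d * (d * c) = c" "d * (inverse d * c) = c"
    by simp_all
  show "q = d + t" and tt: "t * t = 1 - d * t"
    using assms(1) by (simp_all add: assms(3,4) left_diff_distrib)
  show "t * (t * c) = c - d * (t * c)"
    using tt by (simp add: left_diff_distrib flip: mult.assoc)
qed

section \<open>The two maps on generators\<close>

fun xyz_image :: "'k::field \<Rightarrow> xyz_gen \<Rightarrow> (uq_gen, 'k) free_alg"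
  where "xyz_image q GX = gen GK"
  | "xyz_image q GXinv = gen GKinv"
  | "xyz_image q GY = gen GKinv + scal (q - inverse q) * gen GF"
  | "xyz_image q GZ = gen GKinv - scal (q * (q - inverse q)) * (gen GKinv * gen GE)"

fun uq_image :: "'k::field \<Rightarrow> uq_gen \<Rightarrow> (xyz_gen, 'k) free_alg"
  where "uq_image q GK = gen GX"
  | "uq_image q GKinv = gen GXinv"
  | "uq_image q GF = scal (inverse (q - inverse q)) * (gen GY - gen GXinv)"
  | "uq_image q GE = scal (inverse q * inverse (q - inverse q)) * (1 - gen GX * gen GZ)"

text \<open>
Here \<open>P\<close>, \<open>P'\<close>, \<open>KE\<close>, \<open>KF\<close>, \<open>EF\<close> are the relators of \<open>U\<^sub>q(sl\<^sub>2)\<close>. The relation between \<open>x\<close> and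
\<open>y\<close> comes from \<open>KF\<close>, that between \<open>z\<close> and \<open>x\<close> from \<open>KE\<close>, and that between \<open>y\<close> and \<open>z\<close> needs both,
to move \<open>k\<^sup>-\<^sup>1\<close> past \<open>e\<close> and \<open>f\<close>, and then \<open>EF\<close> for the remaining commutator.
\<close>

lemma xyz_relations_hold_in_uq:
  fixes q :: "'k::field"
  assumes q: "q \<noteq> 0" "q ^ 2 \<noteq> 1" and lr: "(l, r) \<in> xyz_relations q"
  shows "subst (xyz_image q) l - subst (xyz_image q) r \<in> relation_ideal (uq_relations q)"
proof -
  let ?I = "relation_ideal (uq_relations q)"
  define t where t: "t = inverse q"
  define d where d: "d = q - inverse q"
  note qtd = quantum_parameter_rewrites(1-4)[OF q t d]
  define k k' e f :: "(uq_gen, 'k) free_alg"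
    where gens: "k = gen GK" "k' = gen GKinv" "e = gen GE" "f = gen GF"
  define P where "P = k' * k - 1"
  define P' where "P' = k * k' - 1"
  define KE where "KE = k * e - scal (q ^ 2) * e * k"
  define KF where "KF = k * f - scal (t ^ 2) * f * k"
  define EF where "EF = e * f - f * e - scal (1 / d) * (k - k')"
  have rels: "P \<in> ?I" "P' \<in> ?I" "KE \<in> ?I" "KF \<in> ?I" "EF \<in> ?I"
    unfolding P_def P'_def KE_def KF_def EF_def gens t d
    by (rule relation_in_relation_ideal; simp add: uq_relations_def Let_def)+
  \<comment> \<open>Conjugation by \<open>k\<^sup>-\<^sup>1\<close> turns the commutation rules of \<open>k\<close> into those of \<open>k\<^sup>-\<^sup>1\<close>; the terms
    with \<open>P\<close> and \<open>P'\<close> account for the products \<open>k\<^sup>-\<^sup>1 k\<close> and \<open>k k\<^sup>-\<^sup>1\<close> so created.\<close>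
  define KE' where "KE' = e * k' - scal (q ^ 2) * k' * e"
  have "KE' = k' * KE * k' - P * e * k' + scal (q ^ 2) * k' * e * P'"
    unfolding KE'_def KE_def P_def P'_def by (simp add: free_alg_normalize)
  then have KE': "KE' \<in> ?I"
    using rels by (auto intro!: relation_ideal_sums intro: relation_ideal_multiples)
  define KF' where "KF' = f * k' - scal (t ^ 2) * k' * f"
  have "KF' = k' * KF * k' - P * f * k' + scal (t ^ 2) * k' * f * P'"
    unfolding KF'_def KF_def P_def P'_def by (simp add: free_alg_normalize)
  then have KF': "KF' \<in> ?I"
    using rels by (auto intro!: relation_ideal_sums intro: relation_ideal_multiples)
  define y where "y = k' + scal d * f"
  define z where "z = k' - scal (q * d) * (k' * e)"
  have "scal q * k * y - scal t * y * k - scal d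
      = scal q * P' - scal t * P + scal (q * d) * KF"
    unfolding y_def KF_def P_def P'_def by (simp add: free_alg_normalize qtd(2-4))
  then have xy: "scal q * k * y - scal t * y * k - scal d \<in> ?I"
    using rels by (auto intro!: relation_ideal_sums intro: relation_ideal_multiples)
  have "scal q * z * k - scal t * k * z - scal d
      = scal q * P - scal t * P' + scal d * (k' * KE - P * e + P' * e)"
    unfolding z_def KE_def P_def P'_def by (simp add: free_alg_normalize qtd(2-4))
  then have zx: "scal q * z * k - scal t * k * z - scal d \<in> ?I"
    using rels by (auto intro!: relation_ideal_sums intro: relation_ideal_multiples)
  \<comment> \<open>The denominator of the commutator relation is cleared so that no \<open>1 / d\<close> occurs below.\<close>
  have EF_d: "scal d * EF = scal d * (e * f - f * e) - (k - k')"
    unfolding EF_def using qtd(1) by (simp add: right_diff_distrib scal_merge)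
  \<comment> \<open>The multiple of \<open>KE'\<close> removes \<open>k\<^sup>-\<^sup>1 e k\<^sup>-\<^sup>1\<close>, the multiple of \<open>KF'\<close> removes \<open>k\<^sup>-\<^sup>1 f\<close>, and
    \<open>KF' * e\<close> turns \<open>f k\<^sup>-\<^sup>1 e\<close> into \<open>k\<^sup>-\<^sup>1 f e\<close>, which completes the commutator.\<close>
  have "scal q * y * z - scal t * z * y - scal d
      = scal d * k' * KE' + scal (q * d) * KF' - scal (q ^ 2 * d ^ 2) * KF' * e
        + scal d * k' * (scal d * EF) + scal d * P"
    unfolding EF_d y_def z_def KE'_def KF'_def P_def
    by (simp add: free_alg_normalize qtd(2-4))
  then have yz: "scal q * y * z - scal t * z * y - scal d \<in> ?I"
    using rels KE' KF' by (auto intro!: relation_ideal_sums intro: relation_ideal_multiples)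
  show ?thesis
    using lr rels(1,2) xy[unfolded y_def gens t] yz[unfolded y_def z_def gens t]
      zx[unfolded z_def gens t] qtd(1)
    by (auto simp: xyz_relations_def Let_def P_def P'_def gens d cleared_relation_mem_iff)
qed

text \<open>
The relators \<open>XY\<close>, \<open>YZ\<close>, \<open>ZX\<close> carry the cleared denominator. For the commutator,
\<open>(1 - x z) (y - x\<^sup>-\<^sup>1) - (y - x\<^sup>-\<^sup>1) (1 - x z) = - x z y + x z x\<^sup>-\<^sup>1 + y x z - x\<^sup>-\<^sup>1 x z\<close>: the relators
\<open>YZ\<close> and \<open>XY\<close> move \<open>y\<close> to the front of \<open>x z y\<close>, \<open>ZX\<close> moves \<open>x\<^sup>-\<^sup>1\<close> past \<open>z\<close>, and what is left is
\<open>q d (x - x\<^sup>-\<^sup>1)\<close> because the coefficient \<open>q\<^sup>2 - 1 - q d\<close> of \<open>z\<close> vanishes.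
\<close>

lemma uq_relations_hold_in_xyz:
  fixes q :: "'k::field"
  assumes q: "q \<noteq> 0" "q ^ 2 \<noteq> 1" and lr: "(l, r) \<in> uq_relations q"
  shows "subst (uq_image q) l - subst (uq_image q) r \<in> relation_ideal (xyz_relations q)"
proof -
  let ?I = "relation_ideal (xyz_relations q)"
  define t where t: "t = inverse q"
  define d where d: "d = q - inverse q"
  define D where D: "D = inverse d"
  note qtd = quantum_parameter_rewrites[OF q t d, folded D]
  define x x' y z :: "(xyz_gen, 'k) free_alg"
    where gens: "x = gen GX" "x' = gen GXinv" "y = gen GY" "z = gen GZ"
  define P where "P = x' * x - 1"
  define P' where "P' = x * x' - 1"
  define XY where "XY = scal q * x * y - scal t * y * x - scal d"
  define YZ where "YZ = scal q * y * z - scal t * z * y - scal d"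
  define ZX where "ZX = scal q * z * x - scal t * x * z - scal d"
  have rels: "P \<in> ?I" "P' \<in> ?I" "XY \<in> ?I" "YZ \<in> ?I" "ZX \<in> ?I"
    unfolding P_def P'_def XY_def YZ_def ZX_def gens t d
    by (rule relation_in_relation_ideal cleared_relation_mem_iff[OF qtd(1), unfolded d, THEN iffD1];
        simp add: relation_in_relation_ideal xyz_relations_def Let_def)+
  define e where "e = scal (t * D) * (1 - x * z)"
  define f where "f = scal D * (y - x')"
  have "x * e - scal (q ^ 2) * e * x = scal D * x * ZX"
    unfolding e_def ZX_def by (simp add: free_alg_normalize qtd(2-8))
  then have ke: "x * e - scal (q ^ 2) * e * x \<in> ?I"
    using rels by (auto intro!: relation_ideal_sums intro: relation_ideal_multiples)
  have "x * f - scal (t ^ 2) * f * x = scal (D * t) * XY - scal D * P' + scal (D * t ^ 2) * P"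
    unfolding f_def XY_def P_def P'_def by (simp add: free_alg_normalize qtd(2-8))
  then have kf: "x * f - scal (t ^ 2) * f * x \<in> ?I"
    using rels by (auto intro!: relation_ideal_sums intro: relation_ideal_multiples)
  have "e * f - f * e - scal D * (x - x') = scal (t * D ^ 2) *
      (scal q * x * YZ - scal q * XY * z - scal q * ZX * x' + scal (q ^ 2) * z * P' - P * z)"
    unfolding e_def f_def XY_def YZ_def ZX_def P_def P'_def
    by (simp add: free_alg_normalize qtd(2-8))
  then have ef: "e * f - f * e - scal D * (x - x') \<in> ?I"
    using rels by (auto intro!: relation_ideal_sums intro: relation_ideal_multiples)
  show ?thesis
    using lr rels(1,2) ke kf ef
    by (auto simp: uq_relations_def Let_def P_def P'_def e_def f_def gens t d D divide_inverse)
qed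

lemma image_coefficients_cancel:
  fixes q :: "'k::field"
  assumes "q \<noteq> 0" "q ^ 2 \<noteq> 1"
  shows "q * (q - inverse q) * (inverse q * inverse (q - inverse q)) = 1"
proof -
  have "a * b * (inverse a * inverse b) = 1" if "a \<noteq> 0" "b \<noteq> 0" for a b :: 'k
    using that by (simp add: field_simps)
  then show ?thesis
    using assms(1) quantum_parameter_rewrites(1)[OF assms refl refl] by blast
qed

lemmas subst_hom_simps = subst_add subst_diff subst_mult subst_scal subst_1 subst_gen

text \<open>
On \<open>x\<close>, \<open>x\<^sup>-\<^sup>1\<close> and \<open>y\<close> the composite is the identity already in the free algebra; on \<open>z\<close> it gives
\<open>x\<^sup>-\<^sup>1 x z\<close>.
\<close>

lemma uq_image_xyz_image:
  fixes q :: "'k::field"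
  assumes q: "q \<noteq> 0" "q ^ 2 \<noteq> 1"
  shows "subst (uq_image q) (xyz_image q g) - gen g \<in> relation_ideal (xyz_relations q)"
proof (cases g)
  case GZ
  let ?P = "gen GXinv * gen GX - 1 :: (xyz_gen, 'k) free_alg"
  have P: "?P \<in> relation_ideal (xyz_relations q)"
    by (rule relation_in_relation_ideal) (simp add: xyz_relations_def Let_def)
  have "subst (uq_image q) (xyz_image q GZ)
      = gen GXinv - scal (q * (q - inverse q) * (inverse q * inverse (q - inverse q)))
          * (gen GXinv * (1 - gen GX * gen GZ))"
    by (simp only: xyz_image.simps uq_image.simps subst_hom_simps
        scal_left_commute[of "gen GXinv"] scal_merge)
  then have "subst (uq_image q) (xyz_image q GZ) - gen GZ = ?P * gen GZ"
    unfolding image_coefficients_cancel[OF q] by (simp add: algebra_simps)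
  then show ?thesis
    using GZ P by (simp add: relation_ideal_rmult)
qed (use quantum_parameter_rewrites(1)[OF q refl refl] in \<open>simp_all add: scal_merge relation_ideal_zero\<close>)

text \<open>
The case of \<open>e\<close> is the only one that uses a relation: the composite gives
\<open>c (1 - k k\<^sup>-\<^sup>1) + k k\<^sup>-\<^sup>1 e\<close> with the scalar \<open>c = q\<^sup>-\<^sup>1 (q - q\<^sup>-\<^sup>1)\<^sup>-\<^sup>1\<close>.
\<close>

lemma xyz_image_uq_image:
  fixes q :: "'k::field"
  assumes q: "q \<noteq> 0" "q ^ 2 \<noteq> 1"
  shows "subst (xyz_image q) (uq_image q g) - gen g \<in> relation_ideal (uq_relations q)"
proof (cases g)
  case GE
  let ?P' = "gen GK * gen GKinv - 1 :: (uq_gen, 'k) free_alg"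
  let ?c = "inverse q * inverse (q - inverse q)"
  have P': "?P' \<in> relation_ideal (uq_relations q)"
    by (rule relation_in_relation_ideal) (simp add: uq_relations_def Let_def)
  have "subst (xyz_image q) (uq_image q GE) = scal ?c * (1 - gen GK * gen GKinv)
      + scal (q * (q - inverse q) * ?c) * (gen GK * (gen GKinv * gen GE))"
    by (simp only: xyz_image.simps uq_image.simps subst_hom_simps right_diff_distrib
        scal_left_commute[of "gen GK"] scal_merge mult.commute[of ?c]) (simp add: algebra_simps)
  then have "subst (xyz_image q) (uq_image q GE) - gen GE = ?P' * gen GE - scal ?c * ?P'"
    unfolding image_coefficients_cancel[OF q] by (simp add: algebra_simps)
  then show ?thesis
    using GE P' by (auto intro!: relation_ideal_sums intro: relation_ideal_multiples)
qed (use quantum_parameter_rewrites(1)[OF q refl refl] in \<open>simp_all add: scal_merge relation_ideal_zero\<close>)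

theorem theorem2p1:
  fixes q :: "'k::field"
  assumes "q \<noteq> 0" and "q ^ 2 \<noteq> 1"
  shows "\<exists>\<phi> \<in> algebra_iso (xyz_algebra q) (Uq_sl2 q).
    \<phi> (xyz q GX) = uq q GK \<and>
    \<phi> (xyz q GXinv) = uq q GKinv \<and>
    \<phi> (xyz q GY) = uq q GKinv \<oplus>\<^bsub>Uq_sl2 q\<^esub> (q - inverse q) \<odot>\<^bsub>Uq_sl2 q\<^esub> uq q GF \<and>
    \<phi> (xyz q GZ) = uq q GKinv
      \<ominus>\<^bsub>Uq_sl2 q\<^esub> (q * (q - inverse q)) \<odot>\<^bsub>Uq_sl2 q\<^esub> (uq q GKinv \<otimes>\<^bsub>Uq_sl2 q\<^esub> uq q GE) \<and>
    (\<exists>\<psi> \<in> algebra_iso (Uq_sl2 q) (xyz_algebra q).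
      (\<forall>a \<in> carrier (xyz_algebra q). \<psi> (\<phi> a) = a) \<and>
      (\<forall>u \<in> carrier (Uq_sl2 q). \<phi> (\<psi> u) = u) \<and>
      \<psi> (uq q GK) = xyz q GX \<and>
      \<psi> (uq q GKinv) = xyz q GXinv \<and>
      \<psi> (uq q GF) = inverse (q - inverse q) \<odot>\<^bsub>xyz_algebra q\<^esub>
        (xyz q GY \<ominus>\<^bsub>xyz_algebra q\<^esub> xyz q GXinv) \<and>
      \<psi> (uq q GE) = (inverse q * inverse (q - inverse q)) \<odot>\<^bsub>xyz_algebra q\<^esub>
        (\<one>\<^bsub>xyz_algebra q\<^esub> \<ominus>\<^bsub>xyz_algebra q\<^esub> xyz q GX \<otimes>\<^bsub>xyz_algebra q\<^esub> xyz q GZ))"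
proof -
  note F = xyz_relations_hold_in_uq[OF assms] and G = uq_relations_hold_in_xyz[OF assms]
    and GF = uq_image_xyz_image[OF assms] and FG = xyz_image_uq_image[OF assms]
  define \<phi> where "\<phi> = presented_hom (xyz_image q) (uq_relations q)"
  define \<psi> where "\<psi> = presented_hom (uq_image q) (xyz_relations q)"
  have iso: "\<phi> \<in> algebra_iso (xyz_algebra q) (Uq_sl2 q)"
    "\<psi> \<in> algebra_iso (Uq_sl2 q) (xyz_algebra q)"
    unfolding \<phi>_def \<psi>_def xyz_algebra_def Uq_sl2_def
    by (rule presented_hom_algebra_iso[OF F G GF FG] presented_hom_algebra_iso[OF G F FG GF];
        assumption)+
  have inv: "\<psi> (\<phi> a) = a" if "a \<in> carrier (xyz_algebra q)" for a
    using presented_hom_inverse[OF F G GF] that by (simp add: \<phi>_def \<psi>_def xyz_algebra_def)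
  have inv': "\<phi> (\<psi> u) = u" if "u \<in> carrier (Uq_sl2 q)" for u
    using presented_hom_inverse[OF G F FG] that by (simp add: \<phi>_def \<psi>_def Uq_sl2_def)
  have \<phi>_gen: "\<phi> (xyz q g) = cls (uq_relations q) (xyz_image q g)" for g
    using presented_hom_cls[OF F] by (simp add: \<phi>_def xyz_def presented_gen_eq_cls)
  have \<psi>_gen: "\<psi> (uq q g) = cls (xyz_relations q) (uq_image q g)" for g
    using presented_hom_cls[OF G] by (simp add: \<psi>_def uq_def presented_gen_eq_cls)
  note ops = xyz_algebra_def Uq_sl2_def xyz_def uq_def presented_gen_eq_cls
    presented_algebra_cls cls_diff
  show ?thesis
    by (intro bexI[OF _ iso(1)] bexI[OF _ iso(2)] conjI ballI inv inv')
       (simp_all only: \<phi>_gen \<psi>_gen xyz_image.simps uq_image.simps, simp_all add: ops)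
qed
end
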